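(* Let $X$ be any origami and $\alpha\in\mathbb R$ be an irrational slope. For any $p\in X$ outside the singular leaves of the linear flow $\phi_\alpha$ we have $$H(X,\alpha,p)\geq w(\alpha),$$ where $H(X,\alpha,p)$ is the hitting time and $w(\alpha)$ is the diophantine type of $\alpha$.
   Context: **Origamis.** Let $\mathcal Q$ be a finite set and $(h,v)$ a pair of permutations of $\mathcal Q$ generating a transitive subgroup of the symmetric group. The origami $X$ defined by $(h,v)$ is the surface obtained from the squares $Q_j=\{j\}\times[0,1]^2$, $j\in\mathcal Q$, by gluing (by translation), for every $j$, the right side of $Q_j$ to the left side of $Q_{h(j)}$ and the top side of $Q_j$ to the bottom side of $Q_{v(j)}$. The map $(j,x)\mapsto [x]$ induces a covering $\rho_X:X\to\mathbb T^2=\mathbb R^2/\mathbb Z^2$, ramified only over $[0]$. The points $p_1,\dots,p_m$ of $X$ where $\rho_X$ is ramified are the conical points; $X$ inherits a metric which is flat outside these points and has conical angle $2(k_j+1)\pi$ at $p_j$, where $k_j+1$ is the ramification index ($k_j\ge 1$). $\mathrm{Dist}(\cdot,\cdot)$ denotes the corresponding distance on $X$, which equals the euclidean distance on small enough discs in $X\setminus\{p_1,\dots,p_m\}$. **Linear flow.** For $\alpha\in\mathbb R\cup\{\infty\}$ let $\theta=\arctan\alpha\in(-\pi/2,\pi/2]$ and $e_\alpha=(\sin\theta,\cos\theta)$ (slopes are measured as $x/y$, so slope $0$ is vertical). The linear flow $\phi_\alpha$ on $X$ is the continuous flow determined by $\rho_X(\phi_\alpha(t,p))=\rho_X(p)+te_\alpha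 \bmod \mathbb Z^2$. There are $k_j+1$ trajectories starting at each conical point $p_j$ and $k_j+1$ trajectories ending at $p_j$ (trajectories stop when they hit a conical point); these are called the singular leaves. The flow is a regular $\mathbb R$-action outside singular leaves. **Diophantine type.** $w(\alpha)=\sup\{w>0: |\alpha-p/q|<q^{-(w+1)}\text{ for infinitely many }p/q\in\mathbb Q\}$, with $p,q$ coprime. **Hitting time.** For $p\in X$ and $r>0$, $$T(X,\alpha,p,r)=\sup_{\widetilde p\in X}\ \inf\{t>r:\mathrm{Dist}(\phi_\alpha(t,p),\widetilde p)<r\},$$ and $$H(X,\alpha,p)=\limsup_{r\to0^+}\frac{\log T(X,\alpha,p,r)}{-\log r}.$$ *)

theory Defs
  imports "HOL-Analysis.Analysis" "HOL-Algebra.Bij" "HOL-Algebra.Generated_Groups"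
begin

section \<open>Quotient topologies and the torus\<close>

definition quotient_topology :: "'a topology \<Rightarrow> ('a \<Rightarrow> 'b) \<Rightarrow> 'b topology" where
  "quotient_topology T f =
     topology (\<lambda>U. U \<subseteq> f ` topspace T \<and> openin T {x \<in> topspace T. f x \<in> U})"

lemma openin_quotient_topology:
  "openin (quotient_topology T f) U \<longleftrightarrow>
     U \<subseteq> f ` topspace T \<and> openin T {x \<in> topspace T. f x \<in> U}"
proof -
  have "istopology (\<lambda>U. U \<subseteq> f ` topspace T \<and> openin T {x \<in> topspace T. f x \<in> U})"
    unfolding istopology_def
  proof (intro conjI allI impI)
    fix S U
    assume S: "S \<subseteq> f ` topspace T \<and> openin T {x \<in> topspace T. f x \<in> S}"
      and U: "U \<subseteq> f ` topspace T \<and> openin T {x \<in> topspace T. f x \<in> U}"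
    have "{x \<in> topspace T. f x \<in> S \<inter> U} =
        {x \<in> topspace T. f x \<in> S} \<inter> {x \<in> topspace T. f x \<in> U}"
      by auto
    then show "openin T {x \<in> topspace T. f x \<in> S \<inter> U}"
      using S U by auto
    show "S \<inter> U \<subseteq> f ` topspace T"
      using S by auto
  next
    fix \<K>
    assume K: "\<forall>K\<in>\<K>. K \<subseteq> f ` topspace T \<and> openin T {x \<in> topspace T. f x \<in> K}"
    have "{x \<in> topspace T. f x \<in> \<Union>\<K>} = (\<Union>K\<in>\<K>. {x \<in> topspace T. f x \<in> K})"
      by auto
    then show "openin T {x \<in> topspace T. f x \<in> \<Union>\<K>}"
      using K by auto
    show "\<Union>\<K> \<subseteq> f ` topspace T"
      using K by auto
  qed
  then show ?thesis
    by (simp add: quotient_topology_def)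
qed

lemma topspace_quotient_topology: "topspace (quotient_topology T f) = f ` topspace T"
proof (rule antisym)
  show "topspace (quotient_topology T f) \<subseteq> f ` topspace T"
    using openin_topspace[of "quotient_topology T f"]
    unfolding openin_quotient_topology by simp
  have "{x \<in> topspace T. f x \<in> f ` topspace T} = topspace T"
    by auto
  then have "openin (quotient_topology T f) (f ` topspace T)"
    by (simp add: openin_quotient_topology)
  then show "f ` topspace T \<subseteq> topspace (quotient_topology T f)"
    by (rule openin_subset)
qed

lemma quotient_map_quotient_topology: "quotient_map T (quotient_topology T f) f"
  by (auto simp: quotient_map_def topspace_quotient_topology openin_quotient_topology)

text \<open>Points of the torus are the cosets of the integer lattice in the plane.\<close>

definition torus_proj :: "real \<times> real \<Rightarrow> (real \<times> real) set" where
  "torus_proj z = {w. fst w - fst z \<in> \<int> \<and> snd w - snd z \<in> \<int>}"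

lemma torus_proj_eqI:
  assumes "fst z - fst w \<in> \<int>" "snd z - snd w \<in> \<int>"
  shows "torus_proj z = torus_proj w"
proof -
  have "c - a \<in> \<int> \<longleftrightarrow> c - b \<in> \<int>" if "a - b \<in> \<int>" for a b c :: real
    using that Ints_add[of "c - a" "a - b"] Ints_diff[of "c - b" "a - b"] by auto
  from this[OF assms(1)] this[OF assms(2)] show ?thesis
    by (simp add: torus_proj_def)
qed

definition torus_topology :: "(real \<times> real) set topology" where
  "torus_topology = quotient_topology euclidean torus_proj"

definition torus_translate :: "real \<times> real \<Rightarrow> (real \<times> real) set \<Rightarrow> (real \<times> real) set" where
  "torus_translate u c = (\<lambda>z. z + u) ` c"

lemma torus_translate_proj: "torus_translate u (torus_proj z) = torus_proj (z + u)"
proof -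
  have "w \<in> (\<lambda>z. z + u) ` torus_proj z" if "w \<in> torus_proj (z + u)" for w
    using that by (intro image_eqI[of _ _ "w - u"]) (auto simp: torus_proj_def algebra_simps)
  then show ?thesis
    by (auto simp: torus_translate_def torus_proj_def)
qed


section \<open>Origamis\<close>

record 'a origami_data =
  squares :: "'a set"
  right_perm :: "'a \<Rightarrow> 'a"
  up_perm :: "'a \<Rightarrow> 'a"

text \<open>
  The case of no squares is excluded, so that the surface is nonempty.
  \<^const>\<open>Bij\<close> makes the permutations undefined outside the set of squares; they
  are then elements of the symmetric group \<^const>\<open>BijGroup\<close>.
\<close>

definition origami :: "'a origami_data \<Rightarrow> bool" where
  "origami X \<longleftrightarrow>
     finite (squares X) \<and> squares X \<noteq> {} \<and>
     right_perm X \<in> Bij (squares X) \<and> up_perm X \<in> Bij (squares X) \<and>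
     (\<forall>i\<in>squares X. \<forall>j\<in>squares X.
        \<exists>g\<in>generate (BijGroup (squares X)) {right_perm X, up_perm X}. g i = j)"

definition unit_square :: "(real \<times> real) set" where
  "unit_square = {0..1} \<times> {0..1}"

definition tiles :: "'a origami_data \<Rightarrow> ('a \<times> real \<times> real) set" where
  "tiles X = squares X \<times> unit_square"

definition tiles_topology :: "'a origami_data \<Rightarrow> ('a \<times> real \<times> real) topology" where
  "tiles_topology X = prod_topology (discrete_topology (squares X)) (top_of_set unit_square)"

definition side_pairing :: "'a origami_data \<Rightarrow> ('a \<times> real \<times> real) rel" where
  "side_pairing X =
     {((j, (1, y)), (right_perm X j, (0, y))) | j y. j \<in> squares X \<and> y \<in> {0..1}} \<union>
     {((j, (x, 1)), (up_perm X j, (x, 0))) | j x. j \<in> squares X \<and> x \<in> {0..1}}"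

definition gluing :: "'a origami_data \<Rightarrow> ('a \<times> real \<times> real) rel" where
  "gluing X = (side_pairing X \<union> (side_pairing X)\<inverse>)\<^sup>* \<inter> tiles X \<times> tiles X"

lemma equiv_gluing: "equiv (tiles X) (gluing X)"
proof (rule equivI)
  show "gluing X \<subseteq> tiles X \<times> tiles X"
    by (auto simp: gluing_def)
  show "refl_on (tiles X) (gluing X)"
    by (auto simp: refl_on_def gluing_def)
  have "sym ((side_pairing X \<union> (side_pairing X)\<inverse>)\<^sup>*)"
    by (intro sym_rtrancl sym_Un_converse)
  then show "sym (gluing X)"
    by (auto simp: gluing_def sym_def)
  show "trans (gluing X)"
    by (auto simp: gluing_def trans_def intro: rtrancl_trans)
qed

type_synonym 'a point = "('a \<times> real \<times> real) set"

definition glued :: "'a origami_data \<Rightarrow> 'a \<times> real \<times> real \<Rightarrow> 'a point" where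
  "glued X a = gluing X `` {a}"

definition surface :: "'a origami_data \<Rightarrow> 'a point set" where
  "surface X = tiles X // gluing X"

definition surface_topology :: "'a origami_data \<Rightarrow> 'a point topology" where
  "surface_topology X = quotient_topology (tiles_topology X) (glued X)"

lemma topspace_surface_topology: "topspace (surface_topology X) = surface X"
  by (auto simp: surface_topology_def topspace_quotient_topology tiles_topology_def
      surface_def quotient_def glued_def tiles_def)

definition covering :: "'a point \<Rightarrow> (real \<times> real) set" where
  "covering p = the_elem ((torus_proj \<circ> snd) ` p)"

lemma torus_proj_gluing:
  assumes "(a, b) \<in> gluing X"
  shows "torus_proj (snd a) = torus_proj (snd b)"
proof -
  have "(a, b) \<in> (side_pairing X \<union> (side_pairing X)\<inverse>)\<^sup>*"
    using assms by (simp add: gluing_def)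
  then show ?thesis
  proof induction
    case base
    show ?case ..
  next
    case (step b c)
    then have "torus_proj (snd b) = torus_proj (snd c)"
      by (auto simp: side_pairing_def intro!: torus_proj_eqI)
    with step show ?case by simp
  qed
qed

lemma covering_glued:
  assumes "a \<in> tiles X"
  shows "covering (glued X a) = torus_proj (snd a)"
proof -
  have a: "a \<in> glued X a"
    using assms by (auto simp: glued_def gluing_def)
  have "(torus_proj \<circ> snd) ` glued X a = (\<lambda>b. torus_proj (snd a)) ` glued X a"
  proof (rule image_cong[OF HOL.refl])
    fix b assume "b \<in> glued X a"
    then show "(torus_proj \<circ> snd) b = torus_proj (snd a)"
      using torus_proj_gluing[of a b X] unfolding glued_def comp_apply by simp
  qed
  also have "\<dots> = {torus_proj (snd a)}"
    using a by (rule image_constant)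
  finally show ?thesis
    unfolding covering_def by simp
qed

text \<open>The covering is unramified at a point iff it is a local homeomorphism there.\<close>

definition conical_points :: "'a origami_data \<Rightarrow> 'a point set" where
  "conical_points X =
     {p \<in> surface X. \<not> (\<exists>U V. p \<in> U \<and> openin (surface_topology X) U \<and> openin torus_topology V \<and>
        homeomorphic_map (subtopology (surface_topology X) U) (subtopology torus_topology V)
          covering)}"

text \<open>
  The distance is the length distance of the flat metric: the infimum of the lengths of
  the piecewise linear paths, each linear piece of which lies in one closed square.
  \<open>broken_line X p q l\<close> says that there is such a path of length \<open>l\<close> from \<open>p\<close> to \<open>q\<close>. The metric
  \<^const>\<open>dist\<close> on pairs of reals is the euclidean one.
\<close>

inductive broken_line :: "'a origami_data \<Rightarrow> 'a point \<Rightarrow> 'a point \<Rightarrow> real \<Rightarrow> bool"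
  for X :: "'a origami_data" where
  refl: "p \<in> surface X \<Longrightarrow> broken_line X p p 0"
| step: "broken_line X p (glued X (j, z)) l \<Longrightarrow> (j, z) \<in> tiles X \<Longrightarrow> (j, z') \<in> tiles X \<Longrightarrow>
    broken_line X p (glued X (j, z')) (l + dist z z')"

definition Dist :: "'a origami_data \<Rightarrow> 'a point \<Rightarrow> 'a point \<Rightarrow> real" where
  "Dist X p q = Inf {l. broken_line X p q l}"


section \<open>The linear flow\<close>

definition direction :: "real \<Rightarrow> real \<times> real" where
  "direction \<alpha> = (sin (arctan \<alpha>), cos (arctan \<alpha>))"

text \<open>
  \<open>flows_to X \<alpha> p t q\<close> is the graph of the linear flow for times \<open>t \<ge> 0\<close>: it says that \<open>q\<close> is
  the point at time \<open>t\<close> of a trajectory that starts at \<open>p\<close>. A relation is used since the flow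
  is a partial function, and multivalued at the conical points: a trajectory stops when it
  hits a conical point, and several trajectories start at such a point. For \<open>p\<close> outside the
  singular leaves there is exactly one \<open>q\<close> for every \<open>t \<ge> 0\<close>.
\<close>

definition flows_to :: "'a origami_data \<Rightarrow> real \<Rightarrow> 'a point \<Rightarrow> real \<Rightarrow> 'a point \<Rightarrow> bool" where
  "flows_to X \<alpha> p t q \<longleftrightarrow> 0 \<le> t \<and>
     (\<exists>\<gamma>. continuous_map (top_of_set {0..t}) (surface_topology X) \<gamma> \<and> \<gamma> 0 = p \<and> \<gamma> t = q \<and>
        (\<forall>s\<in>{0..t}. covering (\<gamma> s) = torus_translate (s *\<^sub>R direction \<alpha>) (covering p)) \<and>
        (\<forall>s\<in>{0<..<t}. \<gamma> s \<notin> conical_points X))"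

definition singular_leaves :: "'a origami_data \<Rightarrow> real \<Rightarrow> 'a point set" where
  "singular_leaves X \<alpha> =
     {p \<in> surface X. \<exists>c\<in>conical_points X. \<exists>t. flows_to X \<alpha> c t p \<or> flows_to X \<alpha> p t c}"


section \<open>Diophantine type and hitting time\<close>

definition diophantine_type :: "real \<Rightarrow> ereal" where
  "diophantine_type \<alpha> =
     Sup {ereal w | w. w > 0 \<and>
       infinite {(p :: int, q :: int). q > 0 \<and> coprime p q \<and>
         \<bar>\<alpha> - real_of_int p / real_of_int q\<bar> < real_of_int q powr (- (w + 1))}}"

text \<open>The infimum of the empty set of times is \<open>\<infinity>\<close>.\<close>

definition hitting_time :: "'a origami_data \<Rightarrow> real \<Rightarrow> 'a point \<Rightarrow> real \<Rightarrow> ereal" where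
  "hitting_time X \<alpha> p r =
     (SUP p'\<in>surface X. Inf {ereal t | t. t > r \<and> (\<exists>q. flows_to X \<alpha> p t q \<and> Dist X q p' < r)})"

text \<open>Only used for positive arguments, with \<open>log \<infinity> = \<infinity>\<close>.\<close>

definition ereal_log :: "ereal \<Rightarrow> ereal" where
  "ereal_log x = (if x = \<infinity> then \<infinity> else ereal (ln (real_of_ereal x)))"

definition hitting_exponent :: "'a origami_data \<Rightarrow> real \<Rightarrow> 'a point \<Rightarrow> ereal" where
  "hitting_exponent X \<alpha> p =
     Limsup (at_right 0) (\<lambda>r. ereal_log (hitting_time X \<alpha> p r) / ereal (- ln r))"

end

theory Submission
  imports Defs "HOL-Real_Asymp.Real_Asymp"
begin

text \<open>
  Let \<open>p/q\<close> be a rational with \<open>\<bar>\<alpha> - p/q\<bar> < q\<^bsup>-(w+1)\<^esup>\<close>. The linear form \<open>q x - p y\<close> is well defined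
  modulo \<open>1\<close> on the torus, hence on \<open>X\<close>. Along the flow it varies at speed less than \<open>q\<^bsup>-w\<^esup>\<close>,
  so up to time \<open>q\<^bsup>w\<^esup>/4\<close> it stays at distance at least \<open>1/4\<close> in \<open>\<real>/\<int>\<close> from the value antipodal to
  its initial one. It is Lipschitz with a constant of order \<open>q\<close>, so for \<open>r\<close> of order \<open>1/q\<close> the
  \<open>r\<close>-ball about a point with the antipodal value is not hit before time \<open>q\<^bsup>w\<^esup>/4\<close>.
\<close>

section \<open>The glued surface and its connectedness by broken lines\<close>

lemma glued_mem_surface: "a \<in> tiles X \<Longrightarrow> glued X a \<in> surface X"
  by (simp add: glued_def surface_def quotientI)

lemma surfaceE:
  assumes "P \<in> surface X"
  obtains j z where "(j, z) \<in> tiles X" "P = glued X (j, z)"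
  using assms unfolding surface_def glued_def quotient_def by auto

lemma glued_side_pairing:
  assumes "(a, b) \<in> side_pairing X" "a \<in> tiles X" "b \<in> tiles X"
  shows "glued X a = glued X b"
proof -
  have "(a, b) \<in> gluing X"
    using assms by (auto simp: gluing_def)
  then show ?thesis
    unfolding glued_def by (rule equiv_class_eq[OF equiv_gluing])
qed

lemma origami_perm_mem:
  assumes "origami X" "j \<in> squares X"
  shows "right_perm X j \<in> squares X" "up_perm X j \<in> squares X"
proof -
  have "right_perm X \<in> Bij (squares X)" "up_perm X \<in> Bij (squares X)"
    using assms(1) by (simp_all add: origami_def)
  then show "right_perm X j \<in> squares X" "up_perm X j \<in> squares X"
    using assms(2) by (blast dest: Bij_imp_funcset)+
qed

lemma glued_right:
  assumes "origami X" "j \<in> squares X"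
  shows "glued X (j, (1, 0)) = glued X (right_perm X j, (0, 0))"
  by (rule glued_side_pairing)
    (use assms origami_perm_mem in \<open>auto simp: side_pairing_def tiles_def unit_square_def\<close>)

lemma glued_up:
  assumes "origami X" "j \<in> squares X"
  shows "glued X (j, (0, 1)) = glued X (up_perm X j, (0, 0))"
  by (rule glued_side_pairing)
    (use assms origami_perm_mem in \<open>auto simp: side_pairing_def tiles_def unit_square_def\<close>)

text \<open>Since a square is convex, reaching one of its points means reaching all of them. The
  predicate thus depends on the label \<open>j\<close> alone, and can be carried along the action of
  the permutation group on labels.\<close>

definition reaches_tile :: "'a origami_data \<Rightarrow> 'a point \<Rightarrow> 'a \<Rightarrow> bool" where
  "reaches_tile X P j \<longleftrightarrow> (\<exists>z\<in>unit_square. \<exists>l. broken_line X P (glued X (j, z)) l)"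

lemma reaches_tileD:
  assumes "reaches_tile X P j" "j \<in> squares X" "z \<in> unit_square"
  shows "\<exists>l. broken_line X P (glued X (j, z)) l"
proof -
  obtain z' l where "z' \<in> unit_square" "broken_line X P (glued X (j, z')) l"
    using assms(1) unfolding reaches_tile_def by blast
  then have "broken_line X P (glued X (j, z)) (l + dist z' z)"
    using assms(2,3) by (intro broken_line.step) (auto simp: tiles_def)
  then show ?thesis ..
qed

text \<open>The squares \<open>j\<close> and \<open>h j\<close> share a corner: the lower right or
  upper left one of \<open>j\<close> is the lower left one of \<open>h j\<close>. The equivalence,
  rather than one implication, is what handles inverses of the generators.\<close>

lemma reaches_tile_perm:
  assumes X: "origami X" and j: "j \<in> squares X" and h: "h \<in> {right_perm X, up_perm X}"
  shows "reaches_tile X P (h j) \<longleftrightarrow> reaches_tile X P j"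
proof -
  have 1: "h j \<in> squares X"
    using X j h origami_perm_mem by auto
  have "(1, 0) \<in> unit_square" "(0, 1) \<in> unit_square"
    by (auto simp: unit_square_def)
  then obtain z where z: "z \<in> unit_square" "glued X (j, z) = glued X (h j, (0, 0))"
    using h glued_right[OF X j] glued_up[OF X j] by blast
  have "(0, 0) \<in> unit_square"
    by (simp add: unit_square_def)
  then show ?thesis
    using reaches_tileD[of X P j z] reaches_tileD[of X P "h j" "(0, 0)"] z 1 j
    unfolding reaches_tile_def by metis
qed

text \<open>Induction on the generated subgroup. Membership in \<open>Bij\<close> is part of the
  induction because products in \<open>BijGroup\<close> are composition only for elements of the
  carrier.\<close>

lemma reaches_tile_generate:
  assumes X: "origami X"
    and g: "g \<in> generate (BijGroup (squares X)) {right_perm X, up_perm X}"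
  shows "g \<in> Bij (squares X) \<and> (\<forall>j\<in>squares X. reaches_tile X P j \<longrightarrow> reaches_tile X P (g j))"
proof -
  have B: "h \<in> Bij (squares X)" if "h \<in> {right_perm X, up_perm X}" for h
    using X that by (auto simp: origami_def)
  show ?thesis
    using g
  proof induction
    case one
    then show ?case
      using id_Bij by (auto simp: BijGroup_def restrict_def)
  next
    case (incl h)
    then show ?case
      using B reaches_tile_perm[OF X] by blast
  next
    case (inv h)
    have eq: "inv\<^bsub>BijGroup (squares X)\<^esub> h = (\<lambda>x\<in>squares X. inv_into (squares X) h x)"
      using B[OF inv] by (rule inv_BijGroup)
    have "reaches_tile X P (inv_into (squares X) h j)"
      if "j \<in> squares X" "reaches_tile X P j" for j
    proof -
      have "h ` squares X = squares X"
        using B[OF inv] by (simp add: Bij_def bij_betw_def)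
      then have "inv_into (squares X) h j \<in> squares X" "h (inv_into (squares X) h j) = j"
        using that by (auto intro: inv_into_into f_inv_into_f)
      then show ?thesis
        using reaches_tile_perm[OF X _ inv] that by metis
    qed
    then show ?case
      unfolding eq using restrict_inv_into_Bij[OF B[OF inv]]
      by (auto simp only: restrict_apply')
  next
    case (eng h1 h2)
    then show ?case
    proof -
      have eq: "h1 \<otimes>\<^bsub>BijGroup (squares X)\<^esub> h2 = compose (squares X) h1 h2"
        using eng.IH by (simp add: BijGroup_def)
      have "h2 j \<in> squares X" if "j \<in> squares X" for j
        using eng.IH that Bij_imp_funcset by blast
      then show ?thesis
        unfolding eq using eng.IH compose_Bij by (metis compose_eq)
    qed
  qed
qed

text \<open>
  Without connectedness, \<^const>\<open>Dist\<close> could be the unspecified infimum of the empty set of reals.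
\<close>

lemma broken_line_exists:
  assumes X: "origami X" and P: "P \<in> surface X" and Q: "Q \<in> surface X"
  shows "\<exists>l. broken_line X P Q l"
proof -
  obtain i z where i: "(i, z) \<in> tiles X" "P = glued X (i, z)"
    using P by (rule surfaceE)
  obtain j z' where j: "(j, z') \<in> tiles X" "Q = glued X (j, z')"
    using Q by (rule surfaceE)
  have ij: "i \<in> squares X" "j \<in> squares X" and z: "z \<in> unit_square" "z' \<in> unit_square"
    using i j by (auto simp: tiles_def)
  obtain g where g: "g \<in> generate (BijGroup (squares X)) {right_perm X, up_perm X}" "g i = j"
    using X ij unfolding origami_def by blast
  have "reaches_tile X P i"
    using broken_line.refl[OF P] i z unfolding reaches_tile_def by blast
  then have "reaches_tile X P j"
    using reaches_tile_generate[OF X g(1)] g(2) ij by blast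
  then show ?thesis
    unfolding j(2) using ij(2) z(2) by (rule reaches_tileD)
qed

lemma Dist_lessD:
  assumes "origami X" "P \<in> surface X" "Q \<in> surface X" "Dist X P Q < r"
  obtains l where "broken_line X P Q l" "l < r"
proof -
  have "{l. broken_line X P Q l} \<noteq> {}"
    using broken_line_exists[OF assms(1-3)] by blast
  then show ?thesis
    using cInf_lessD[of "{l. broken_line X P Q l}" r] assms(4) that unfolding Dist_def by blast
qed

section \<open>The linear form modulo 1 on the torus, along broken lines and along the flow\<close>

lemma torus_proj_eqD:
  assumes "torus_proj z = torus_proj w"
  shows "fst z - fst w \<in> \<int>" "snd z - snd w \<in> \<int>"
proof -
  have "z \<in> torus_proj w"
    unfolding assms[symmetric] by (simp add: torus_proj_def)
  then show "fst z - fst w \<in> \<int>" "snd z - snd w \<in> \<int>"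
    by (simp_all add: torus_proj_def)
qed

definition lin_form :: "int \<Rightarrow> int \<Rightarrow> real \<times> real \<Rightarrow> real" where
  "lin_form p q z = of_int q * fst z - of_int p * snd z"

lemma lin_form_torus:
  assumes "torus_proj z = torus_proj w"
  shows "lin_form p q z - lin_form p q w \<in> \<int>"
proof -
  have "lin_form p q z - lin_form p q w =
      of_int q * (fst z - fst w) - of_int p * (snd z - snd w)"
    by (simp add: lin_form_def algebra_simps)
  then show ?thesis
    using torus_proj_eqD[OF assms] by simp
qed

lemma lin_form_lipschitz:
  "\<bar>lin_form p q z - lin_form p q w\<bar> \<le> (\<bar>of_int p\<bar> + \<bar>of_int q\<bar>) * dist z w"
proof -
  have "lin_form p q z - lin_form p q w =
      of_int q * (fst z - fst w) - of_int p * (snd z - snd w)"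
    by (simp add: lin_form_def algebra_simps)
  also have "\<bar>\<dots>\<bar> \<le> \<bar>of_int q\<bar> * \<bar>fst z - fst w\<bar> + \<bar>of_int p\<bar> * \<bar>snd z - snd w\<bar>"
    by (rule order_trans[OF abs_triangle_ineq4]) (simp add: abs_mult)
  also have "\<dots> \<le> \<bar>of_int q\<bar> * dist z w + \<bar>of_int p\<bar> * dist z w"
    using dist_fst_le[of z w] dist_snd_le[of z w]
    by (intro add_mono mult_left_mono) (auto simp: dist_real_def)
  finally show ?thesis
    by (simp add: algebra_simps)
qed

text \<open>Within one square the form is Lipschitz in the coordinates; passing to another square
  changes coordinates by a lattice vector, hence the form by an integer. The induction leaves
  \<open>z'\<close> arbitrary, so that each step can choose its own representative of the
  endpoint.\<close>

lemma broken_line_lin_form: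
  assumes "broken_line X P Q l" "covering P = torus_proj z" "covering Q = torus_proj z'"
  shows "\<exists>n\<in>\<int>. \<bar>lin_form p q z' - lin_form p q z - n\<bar> \<le> (\<bar>of_int p\<bar> + \<bar>of_int q\<bar>) * l"
  using assms
proof (induction arbitrary: z' rule: broken_line.induct)
  case (refl P)
  then have "lin_form p q z' - lin_form p q z \<in> \<int>"
    by (intro lin_form_torus) simp
  then show ?case
    by (intro bexI[of _ "lin_form p q z' - lin_form p q z"]) auto
next
  case (step P j y l y')
  let ?K = "\<bar>of_int p\<bar> + \<bar>of_int q\<bar> :: real"
  have "covering (glued X (j, y)) = torus_proj y"
    using step.hyps by (simp add: covering_glued)
  then obtain n where n: "n \<in> \<int>" "\<bar>lin_form p q y - lin_form p q z - n\<bar> \<le> ?K * l"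
    using step.IH step.prems by blast
  have m: "lin_form p q z' - lin_form p q y' \<in> \<int>"
    using step.prems step.hyps by (intro lin_form_torus) (simp add: covering_glued)
  have "\<bar>lin_form p q y - lin_form p q y'\<bar> \<le> ?K * dist y y'"
    by (rule lin_form_lipschitz)
  then have "\<bar>lin_form p q z' - lin_form p q z - (n + (lin_form p q z' - lin_form p q y'))\<bar>
      \<le> ?K * (l + dist y y')"
    using n(2) unfolding distrib_left by linarith
  then show ?case
    using Ints_add[OF n(1) m] by blast
qed

text \<open>Slopes are measured as x/y, so the sine is \<alpha> times the cosine and the speed of
  the form is a cosine times \<open>q * \<alpha> - p\<close>, which is small for a good
  approximant.\<close>

lemma lin_form_flow:
  "lin_form p q (z + t *\<^sub>R direction \<alpha>) =
     lin_form p q z + t * cos (arctan \<alpha>) * (of_int q * \<alpha> - of_int p)"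
proof -
  have "sin (arctan \<alpha>) = \<alpha> * cos (arctan \<alpha>)"
    by (simp add: sin_arctan cos_arctan)
  then show ?thesis
    by (simp add: lin_form_def direction_def algebra_simps)
qed

section \<open>Lower bound for the hitting time from one approximant\<close>

lemma hitting_time_ge:
  fixes p q :: int
  assumes X: "origami X" and P: "P \<in> surface X" and q: "q > 0"
    and \<delta>: "\<bar>of_int q * \<alpha> - of_int p\<bar> \<le> \<delta>" "\<delta> > 0"
    and r: "(\<bar>of_int p\<bar> + of_int q) * r \<le> 1/4"
  shows "hitting_time X \<alpha> P r \<ge> ereal (1 / (4 * \<delta>))"
proof -
  let ?f = "lin_form p q"
  let ?K = "\<bar>of_int p\<bar> + \<bar>of_int q\<bar> :: real"
  obtain j z where z: "(j, z) \<in> tiles X" "P = glued X (j, z)"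
    using P by (rule surfaceE)
  \<comment> \<open>On the bottom side the form is \<open>q * x\<close>. Solving for the antipodal
    value \<open>?f z + 1/2\<close> and reducing \<open>x\<close> modulo 1 to stay in the square
    costs only the integer \<open>m\<close>, a multiple of \<open>q\<close>.\<close>
  define x where "x = frac ((?f z + 1/2) / of_int q)"
  have "x \<in> {0..1}"
    unfolding x_def using frac_lt_1[of "(?f z + 1/2) / of_int q"] by auto
  then have x: "(j, (x, 0)) \<in> tiles X"
    using z by (auto simp: tiles_def unit_square_def)
  define m where "m = real_of_int (q * \<lfloor>(?f z + 1/2) / of_int q\<rfloor>)"
  have fx: "?f (x, 0) = ?f z + 1/2 - m"
    using q by (simp add: lin_form_def x_def m_def frac_def field_simps)
  have m: "m \<in> \<int>"
    by (simp add: m_def)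
  define Q where "Q = glued X (j, (x, 0))"
  have Q: "Q \<in> surface X" "covering Q = torus_proj (x, 0)"
    using x by (simp_all add: Q_def glued_mem_surface covering_glued)
  have "1 / (4 * \<delta>) \<le> t" if t: "flows_to X \<alpha> P t S" "Dist X S Q < r" for t S
  proof (rule ccontr)
    assume "\<not> 1 / (4 * \<delta>) \<le> t"
    then have t4: "t * \<delta> < 1/4"
      using \<delta>(2) by (simp add: field_simps)
    obtain \<gamma> where t0: "0 \<le> t" and \<gamma>:
      "continuous_map (top_of_set {0..t}) (surface_topology X) \<gamma>" "\<gamma> t = S"
      "\<forall>s\<in>{0..t}. covering (\<gamma> s) = torus_translate (s *\<^sub>R direction \<alpha>) (covering P)"
      using t(1) unfolding flows_to_def by blast
    have S: "S \<in> surface X"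
      using continuous_map_image_subset_topspace[OF \<gamma>(1)] t0 \<gamma>(2)
      by (auto simp: topspace_surface_topology)
    have cov: "covering S = torus_proj (z + t *\<^sub>R direction \<alpha>)"
      using \<gamma>(2,3) t0 z by (auto simp: covering_glued torus_translate_proj)
    obtain l where l: "broken_line X S Q l" "l < r"
      using Dist_lessD[OF X S Q(1) t(2)] .
    obtain n where n: "n \<in> \<int>" "\<bar>?f (x, 0) - ?f (z + t *\<^sub>R direction \<alpha>) - n\<bar> \<le> ?K * l"
      using broken_line_lin_form[OF l(1) cov Q(2)] by blast
    have "?K * l < ?K * r"
      using l(2) q by (intro mult_strict_left_mono) auto
    then have "?K * l < 1/4"
      using r q by simp
    moreover have "\<bar>t * cos (arctan \<alpha>) * (of_int q * \<alpha> - of_int p)\<bar> < 1/4"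
    proof -
      have "\<bar>t * cos (arctan \<alpha>) * (of_int q * \<alpha> - of_int p)\<bar> \<le> t * 1 * \<delta>"
        unfolding abs_mult using t0 \<delta> abs_cos_le_one by (intro mult_mono) auto
      then show ?thesis
        using t4 by simp
    qed
    \<comment> \<open>Drift along the flow and deviation along the broken line are each below 1/4,
      so together they cannot bridge the gap 1/2: the integer \<open>m + n\<close> would lie
      strictly between 0 and 1.\<close>
    ultimately have "\<bar>1/2 - (m + n)\<bar> < 1/2"
      using n(2) unfolding fx lin_form_flow by linarith
    moreover obtain k where "m + n = of_int k"
      using m n(1) by (metis Ints_add Ints_cases)
    ultimately have "0 < real_of_int k" "real_of_int k < 1"
      by linarith+
    then show False
      by simp
  qed
  \<comment> \<open>This also covers the case of no hitting time, where the infimum is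
    infinite.\<close>
  then have "ereal (1 / (4 * \<delta>)) \<le>
      Inf {ereal t | t. t > r \<and> (\<exists>S. flows_to X \<alpha> P t S \<and> Dist X S Q < r)}"
    by (intro Inf_greatest) auto
  also have "\<dots> \<le> hitting_time X \<alpha> P r"
    unfolding hitting_time_def using Q(1) by (rule SUP_upper)
  finally show ?thesis .
qed

section \<open>Passage from infinitely many approximants to the limsup\<close>

text \<open>Bounded denominators also bound the numerators, because all the fractions stay within 1
  of \<alpha>; only finitely many pairs would remain.\<close>

lemma approximants_unbounded:
  fixes N \<alpha> :: real
  assumes inf: "infinite A" and N: "N \<ge> 0"
    and A: "\<And>p q. (p, q) \<in> A \<Longrightarrow> q > 0 \<and> \<bar>\<alpha> - real_of_int p / real_of_int q\<bar> \<le> 1"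
  shows "\<exists>(p, q)\<in>A. real_of_int q > N"
proof (rule ccontr)
  assume *: "\<not> (\<exists>(p, q)\<in>A. real_of_int q > N)"
  let ?M = "\<lceil>N * (\<bar>\<alpha>\<bar> + 1)\<rceil>"
  have "A \<subseteq> {- ?M..?M} \<times> {0..\<lceil>N\<rceil>}"
  proof (clarify)
    fix p q assume pq: "(p, q) \<in> A"
    then have q: "q > 0" "real_of_int q \<le> N" "\<bar>\<alpha> - real_of_int p / real_of_int q\<bar> \<le> 1"
      using * A by fastforce+
    then have "\<bar>real_of_int p / real_of_int q\<bar> \<le> \<bar>\<alpha>\<bar> + 1"
      by linarith
    then have "\<bar>real_of_int p\<bar> \<le> real_of_int q * (\<bar>\<alpha>\<bar> + 1)"
      using q(1) by (simp add: field_simps)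
    also have "\<dots> \<le> N * (\<bar>\<alpha>\<bar> + 1)"
      using q(2) by (intro mult_right_mono) auto
    finally have "\<bar>real_of_int p\<bar> \<le> N * (\<bar>\<alpha>\<bar> + 1)" .
    then have "p \<le> ?M" "- p \<le> ?M" "q \<le> \<lceil>N\<rceil>"
      using q(2) by linarith+
    then show "p \<in> {- ?M..?M} \<and> q \<in> {0..\<lceil>N\<rceil>}"
      using q(1) by auto
  qed
  then have "finite A"
    by (rule finite_subset) simp
  with inf show False ..
qed

lemma ereal_log_ge:
  assumes "ereal c \<le> x" "c > 0"
  shows "ereal (ln c) \<le> ereal_log x"
  using assms by (cases x) (auto simp: ereal_log_def)

theorem lemma1p2:
  fixes X :: "'a origami_data" and \<alpha> :: real and p :: "'a point"
  assumes "origami X"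
    and "\<alpha> \<notin> \<rat>"
    and "p \<in> surface X"
    and "p \<notin> singular_leaves X \<alpha>"
  shows "hitting_exponent X \<alpha> p \<ge> diophantine_type \<alpha>"
  unfolding diophantine_type_def
proof (rule Sup_least, clarify)
  fix w :: real
  let ?A = "{(a :: int, q :: int). q > 0 \<and> coprime a q \<and>
         \<bar>\<alpha> - real_of_int a / real_of_int q\<bar> < real_of_int q powr (- (w + 1))}"
  assume w: "w > 0" and inf: "infinite ?A"
  \<comment> \<open>For an approximant \<open>a/q\<close> one has
    \<open>\<bar>a\<bar> + q \<le> q * (\<bar>\<alpha>\<bar> + 2)\<close>, so
    \<open>r = 1 / (C * q)\<close> meets the radius condition of
    \<open>hitting_time_ge\<close>.\<close>
  define C where "C = 4 * (\<bar>\<alpha>\<bar> + 2)"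
  have C: "C \<ge> 8"
    by (simp add: C_def)
  \<comment> \<open>Arbitrarily small radii whose quotient exceeds any given \<open>y\<close> below
    \<open>w\<close> contradict a limsup below \<open>w\<close>.\<close>
  have frequent: "\<exists>r>0. r < b \<and> y < ereal_log (hitting_time X \<alpha> p r) / ereal (- ln r)"
    if y: "y < ereal w" and b: "b > 0" for y b
  proof -
    obtain c where c: "y < ereal c" "c < w"
      using ereal_dense2[OF y] by auto
    \<comment> \<open>At \<open>x = q\<close> this is the quotient of the logarithms of the time
      bound \<open>q powr w / 4\<close> and of \<open>1 / r = C * q\<close>; the constants disappear
      in the limit.\<close>
    have "eventually (\<lambda>x. c < (w * ln x - ln 4) / (ln C + ln x)) at_top"
    proof -
      have "((\<lambda>x. (w * ln x - ln 4) / (ln C + ln x)) \<longlongrightarrow> w) at_top"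
        using w by real_asymp
      then show ?thesis
        using c(2) by (rule order_tendstoD)
    qed
    then obtain N where N: "\<And>x. x \<ge> N \<Longrightarrow> c < (w * ln x - ln 4) / (ln C + ln x)"
      unfolding eventually_at_top_linorder by blast
    \<comment> \<open>The threshold \<open>N\<close> serves the estimate just obtained, and
      \<open>1 / b\<close> ensures \<open>r < b\<close>.\<close>
    have "\<exists>(a, q)\<in>?A. real_of_int q > max 0 (max N (1 / b))"
    proof (rule approximants_unbounded[OF inf])
      fix a q assume "(a, q) \<in> ?A"
      moreover have "real_of_int q powr (- (w + 1)) \<le> 1" if "q > 0"
        using that w powr_mono[of "- (w + 1)" 0 "real_of_int q"] by simp
      ultimately show "q > 0 \<and> \<bar>\<alpha> - real_of_int a / real_of_int q\<bar> \<le> 1"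
        by fastforce
    qed simp
    then obtain a q where q: "q > 0" "real_of_int q > N" "real_of_int q > 1 / b"
      and a: "\<bar>\<alpha> - real_of_int a / real_of_int q\<bar> < real_of_int q powr (- (w + 1))"
      by auto
    define r where "r = 1 / (C * real_of_int q)"
    define \<delta> where "\<delta> = real_of_int q powr (- w)"
    have r0: "r > 0"
      using C q by (simp add: r_def)
    have "1 < b * real_of_int q"
      using q(3) b by (simp add: field_simps)
    also have "\<dots> \<le> b * (C * real_of_int q)"
      using C b q by simp
    finally have rb: "r < b"
      using C q by (simp add: r_def field_simps)
    have \<delta>: "\<bar>real_of_int q * \<alpha> - real_of_int a\<bar> \<le> \<delta>"
    proof -
      have "\<bar>real_of_int q * \<alpha> - real_of_int a\<bar> =
          real_of_int q * \<bar>\<alpha> - real_of_int a / real_of_int q\<bar>"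
        using q(1) abs_mult_pos[of "real_of_int q" "\<alpha> - real_of_int a / real_of_int q"]
        by (simp add: algebra_simps)
      also have "\<dots> \<le> real_of_int q * real_of_int q powr (- (w + 1))"
        using a q(1) by (intro mult_left_mono) auto
      also have "\<dots> = \<delta>"
        using q(1) powr_add[of "real_of_int q" 1 "- (w + 1)"] by (simp add: \<delta>_def)
      finally show ?thesis .
    qed
    have "\<delta> \<le> 1"
      using q(1) w powr_mono[of "- w" 0 "real_of_int q"] by (simp add: \<delta>_def)
    then have "\<bar>real_of_int a\<bar> \<le> \<bar>real_of_int q * \<alpha>\<bar> + real_of_int q"
      using \<delta> q(1) by linarith
    then have K: "(\<bar>real_of_int a\<bar> + real_of_int q) \<le> real_of_int q * (\<bar>\<alpha>\<bar> + 2)"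
      using q(1) by (simp add: abs_mult algebra_simps)
    have Kr: "(\<bar>real_of_int a\<bar> + real_of_int q) * r \<le> 1/4"
    proof -
      have "(\<bar>real_of_int a\<bar> + real_of_int q) * r \<le> real_of_int q * (\<bar>\<alpha>\<bar> + 2) * r"
        using K r0 by (intro mult_right_mono) auto
      also have "\<dots> = 1/4"
        using q(1) by (simp add: r_def C_def)
      finally show ?thesis .
    qed
    have "ereal (1 / (4 * \<delta>)) \<le> hitting_time X \<alpha> p r"
      using hitting_time_ge[OF assms(1,3) q(1) \<delta> _ Kr] q(1) by (simp add: \<delta>_def)
    then have "ereal (ln (1 / (4 * \<delta>))) \<le> ereal_log (hitting_time X \<alpha> p r)"
      using q(1) by (intro ereal_log_ge) (auto simp: \<delta>_def)
    also have "ln (1 / (4 * \<delta>)) = w * ln (real_of_int q) - ln 4"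
      using q(1) by (simp add: \<delta>_def ln_div ln_mult ln_powr)
    finally have log: "ereal (w * ln (real_of_int q) - ln 4) \<le> ereal_log (hitting_time X \<alpha> p r)" .
    have lr: "- ln r = ln C + ln (real_of_int q)"
      using q(1) C by (simp add: r_def ln_div ln_mult)
    have "ln C > 0" "ln (real_of_int q) \<ge> 0"
      using q(1) C by simp_all
    then have lr0: "- ln r > 0"
      using lr by linarith
    have "y < ereal ((w * ln (real_of_int q) - ln 4) / (- ln r))"
      using c(1) N[of "real_of_int q"] q(2) unfolding lr by (intro order.strict_trans[OF c(1)]) simp
    also have "\<dots> = ereal (w * ln (real_of_int q) - ln 4) / ereal (- ln r)"
      using lr0 by simp
    also have "\<dots> \<le> ereal_log (hitting_time X \<alpha> p r) / ereal (- ln r)"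
      using lr0 log by (intro ereal_divide_right_mono) auto
    finally show ?thesis
      using r0 rb by blast
  qed
  show "ereal w \<le> hitting_exponent X \<alpha> p"
  proof (rule ccontr)
    assume "\<not> ereal w \<le> hitting_exponent X \<alpha> p"
    then have "hitting_exponent X \<alpha> p < ereal w"
      by (simp only: not_le)
    from dense[OF this] obtain y where y: "hitting_exponent X \<alpha> p < y" "y < ereal w"
      by blast
    have "eventually (\<lambda>r. ereal_log (hitting_time X \<alpha> p r) / ereal (- ln r) < y) (at_right 0)"
      using y(1) unfolding hitting_exponent_def by (rule Limsup_lessD)
    then obtain b where "b > 0"
      "\<And>r. 0 < r \<Longrightarrow> r < b \<Longrightarrow> ereal_log (hitting_time X \<alpha> p r) / ereal (- ln r) < y"
      unfolding eventually_at_right_field by blast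
    then show False
      using frequent[OF y(2) \<open>b > 0\<close>] less_asym by blast
  qed
qed

end
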